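(* Both the cut rule and the contraction rule are eliminable from derivations in $EQ'$; that is, every sequent derivable in $EQ'$ has a derivation in $EQ'$ that uses neither the cut rule nor the contraction rule.
   Context: Fix a first-order language with equality $=$. Terms are denoted $r,s,t$. Arbitrary formulae are denoted $F,G,H$; $A$ and $D$ always denote atomic formulae (equalities between terms are atomic formulae). $D\{v/r\}$ is the result of substituting the term $r$ for every occurrence of the variable $v$ in $D$. A sequent is $\Gamma\Rightarrow H$, where $\Gamma$ is a finite (possibly empty) sequence of formulae and exactly one formula $H$ is in the succedent. The calculus $EQ'$ has: - logical axioms $A\Rightarrow A$ ($A$ atomic); - reflexivity axioms $\Rightarrow t=t$; - weakening: from $\Gamma\Rightarrow H$ infer $\Gamma,F\Rightarrow H$; - exchange: from $\Gamma_1,F,G,\Gamma_2\Rightarrow H$ infer $\Gamma_1,G,F,\Gamma_2\Rightarrow H$; - contraction: from $\Gamma,F,F\Rightarrow H$ infer $\Gamma,F\Rightarrow H$; - atomic cut: from $\Gamma\Rightarrow A$ and $\Lambda,A\Rightarrow H$ infer $\Gamma,\Lambda\Rightarrow H$ ($A$ atomic); - context-sharing congruence rule $CNG'$: from $\Gamma\Rightarrow D\{v/r\}$ and $\Gamma\Rightarrow r=s$ infer $\Gamma\Rightarrow D\{v/s\}$ ($D$ atomic). *)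

theory Defs
  imports Main
begin

text \<open>A first-order language assigns an arity to each of its function and predicate symbols;
  \<open>None\<close> means that the symbol does not belong to the language. Either set of symbols
  may thus be empty. Equality is a logical symbol and is not among the predicate symbols.\<close>

record ('f, 'p) lang =
  fun_arity :: "'f \<Rightarrow> nat option"
  pred_arity :: "'p \<Rightarrow> nat option"

type_synonym var = nat

datatype 'f trm = Var var | Fun 'f "'f trm list"

datatype ('f, 'p) atom =
    Eq "'f trm" "'f trm"
  | Pred 'p "'f trm list"

datatype ('f, 'p) form =
    Atom "('f, 'p) atom"
  | Neg "('f, 'p) form"
  | Conj "('f, 'p) form" "('f, 'p) form"
  | Disj "('f, 'p) form" "('f, 'p) form"
  | Imp "('f, 'p) form" "('f, 'p) form"
  | All var "('f, 'p) form"
  | Ex var "('f, 'p) form"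

primrec trm_of :: "('f, 'p) lang \<Rightarrow> 'f trm \<Rightarrow> bool" where
  "trm_of L (Var x) \<longleftrightarrow> True"
| "trm_of L (Fun f ts) \<longleftrightarrow> fun_arity L f = Some (length ts) \<and> list_all (trm_of L) ts"

primrec atom_of :: "('f, 'p) lang \<Rightarrow> ('f, 'p) atom \<Rightarrow> bool" where
  "atom_of L (Eq s t) \<longleftrightarrow> trm_of L s \<and> trm_of L t"
| "atom_of L (Pred p ts) \<longleftrightarrow> pred_arity L p = Some (length ts) \<and> list_all (trm_of L) ts"

primrec form_of :: "('f, 'p) lang \<Rightarrow> ('f, 'p) form \<Rightarrow> bool" where
  "form_of L (Atom A) \<longleftrightarrow> atom_of L A"
| "form_of L (Neg F) \<longleftrightarrow> form_of L F"
| "form_of L (Conj F G) \<longleftrightarrow> form_of L F \<and> form_of L G"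
| "form_of L (Disj F G) \<longleftrightarrow> form_of L F \<and> form_of L G"
| "form_of L (Imp F G) \<longleftrightarrow> form_of L F \<and> form_of L G"
| "form_of L (All x F) \<longleftrightarrow> form_of L F"
| "form_of L (Ex x F) \<longleftrightarrow> form_of L F"

primrec subst_trm :: "'f trm \<Rightarrow> var \<Rightarrow> 'f trm \<Rightarrow> 'f trm" where
  "subst_trm (Var x) v r = (if x = v then r else Var x)"
| "subst_trm (Fun f ts) v r = Fun f (map (\<lambda>t. subst_trm t v r) ts)"

primrec subst_atom :: "('f, 'p) atom \<Rightarrow> var \<Rightarrow> 'f trm \<Rightarrow> ('f, 'p) atom"
    ("_\<lbrace>_'/_\<rbrace>" [1000, 0, 0] 1000) where
  "(Eq s t)\<lbrace>v/r\<rbrace> = Eq (subst_trm s v r) (subst_trm t v r)"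
| "(Pred p ts)\<lbrace>v/r\<rbrace> = Pred p (map (\<lambda>t. subst_trm t v r) ts)"

datatype ('f, 'p) sequent =
  Sequent (antecedent: "('f, 'p) form list") (succedent: "('f, 'p) form")  (infix "\<turnstile>" 50)

datatype rule =
  LogicalAxiom | Reflexivity | Weakening | Exchange | Contraction | Cut | Congruence

text \<open>\<open>EQ' L \<rho> Ss S\<close>: the sequent \<open>S\<close> follows from the list of premises \<open>Ss\<close> by an
  instance, in the language \<open>L\<close>, of the rule \<open>\<rho>\<close>. Where the side condition of membership in
  \<open>L\<close> is omitted, it is inherited from the premises.\<close>

inductive EQ' :: "('f, 'p) lang \<Rightarrow> rule \<Rightarrow> ('f, 'p) sequent list \<Rightarrow> ('f, 'p) sequent \<Rightarrow> bool"
  for L :: "('f, 'p) lang" where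
  logical_axiom:
    "atom_of L A \<Longrightarrow> EQ' L LogicalAxiom [] ([Atom A] \<turnstile> Atom A)"
| reflexivity:
    "trm_of L t \<Longrightarrow> EQ' L Reflexivity [] ([] \<turnstile> Atom (Eq t t))"
| weakening:
    "form_of L F \<Longrightarrow> EQ' L Weakening [\<Gamma> \<turnstile> H] (\<Gamma> @ [F] \<turnstile> H)"
| exchange:
    "EQ' L Exchange [\<Gamma>1 @ [F, G] @ \<Gamma>2 \<turnstile> H] (\<Gamma>1 @ [G, F] @ \<Gamma>2 \<turnstile> H)"
| contraction:
    "EQ' L Contraction [\<Gamma> @ [F, F] \<turnstile> H] (\<Gamma> @ [F] \<turnstile> H)"
| cut:
    "EQ' L Cut [\<Gamma> \<turnstile> Atom A, \<Lambda> @ [Atom A] \<turnstile> H] (\<Gamma> @ \<Lambda> \<turnstile> H)"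
| congruence:
    "atom_of L D \<Longrightarrow>
     EQ' L Congruence [\<Gamma> \<turnstile> Atom (D\<lbrace>v/r\<rbrace>), \<Gamma> \<turnstile> Atom (Eq r s)] (\<Gamma> \<turnstile> Atom (D\<lbrace>v/s\<rbrace>))"

text \<open>Trees whose nodes carry a sequent and the name of the rule by which it is inferred.
  \<open>rules_used\<close>, the set function of the datatype, collects the rule names in the whole tree.\<close>

datatype (rules_used: 'r, sequents_in: 's) tree =
  Infer (last_rule: 'r) (conclusion: 's) (subtrees: "('r, 's) tree list")

primrec is_derivation :: "('f, 'p) lang \<Rightarrow> (rule, ('f, 'p) sequent) tree \<Rightarrow> bool" where
  "is_derivation L (Infer \<rho> S ds) \<longleftrightarrow>
     EQ' L \<rho> (map conclusion ds) S \<and> list_all (is_derivation L) ds"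

definition derivation_of ::
    "('f, 'p) lang \<Rightarrow> (rule, ('f, 'p) sequent) tree \<Rightarrow> ('f, 'p) sequent \<Rightarrow> bool" where
  "derivation_of L d S \<longleftrightarrow> is_derivation L d \<and> conclusion d = S"

definition derivable :: "('f, 'p) lang \<Rightarrow> ('f, 'p) sequent \<Rightarrow> bool" where
  "derivable L S \<longleftrightarrow> (\<exists>d. derivation_of L d S)"

end

theory Submission
  imports Defs
begin

text \<open>No rule of \<open>EQ'\<close> acts on a formula of the antecedent, and \<open>CNG'\<close> shares its context.
  Derivability without cut and contraction therefore depends only on the set of formulae in the
  antecedent, which makes contraction admissible. A cut on \<open>A\<close> is eliminated by grafting the
  derivation of \<open>A\<close> onto the axioms \<open>A \<Rightarrow> A\<close> of the other premise, in the joint context.\<close>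

text \<open>The set \<open>X\<close> absorbs exchange and contraction, and \<open>hypothesis\<close>
  absorbs weakening.\<close>

inductive entails :: "('f, 'p) lang \<Rightarrow> ('f, 'p) form set \<Rightarrow> ('f, 'p) form \<Rightarrow> bool"
  for L :: "('f, 'p) lang" and X :: "('f, 'p) form set" where
  hypothesis: "Atom A \<in> X \<Longrightarrow> entails L X (Atom A)"
| reflexivity: "trm_of L t \<Longrightarrow> entails L X (Atom (Eq t t))"
| congruence:
    "atom_of L D \<Longrightarrow> entails L X (Atom (D\<lbrace>v/r\<rbrace>)) \<Longrightarrow> entails L X (Atom (Eq r s)) \<Longrightarrow>
     entails L X (Atom (D\<lbrace>v/s\<rbrace>))"

text \<open>This is the grafting step: each \<open>hypothesis\<close> leaf is replaced by an
  entailment from \<open>X\<close>, and \<open>congruence\<close> goes through because both its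
  premises have the same context.\<close>

lemma entails_trans:
  assumes "entails L Y H" and "\<And>A. Atom A \<in> Y \<Longrightarrow> entails L X (Atom A)"
  shows "entails L X H"
  using assms by (induction rule: entails.induct) (auto intro: entails.intros)

lemma entails_mono: "entails L Y H \<Longrightarrow> Y \<subseteq> X \<Longrightarrow> entails L X H"
  by (erule entails_trans) (auto intro: entails.hypothesis)

lemma entails_cut:
  assumes "entails L X (Atom A)" and "entails L (insert (Atom A) Y) H"
  shows "entails L (X \<union> Y) H"
  using assms(2)
proof (rule entails_trans)
  fix B assume "Atom B \<in> insert (Atom A) Y"
  then show "entails L (X \<union> Y) (Atom B)"
    using entails_mono[OF assms(1)] by (auto intro: entails.hypothesis)
qed

text \<open>Membership of the antecedent in the language is carried along because rebuilding a
  derivation later requires weakening by these formulae.\<close>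

lemma EQ'_sound:
  assumes "EQ' L \<rho> Ss S"
    and "\<forall>S' \<in> set Ss.
      list_all (form_of L) (antecedent S') \<and> entails L (set (antecedent S')) (succedent S')"
  shows "list_all (form_of L) (antecedent S) \<and> entails L (set (antecedent S)) (succedent S)"
  using assms
proof (cases rule: EQ'.cases)
  case (weakening F \<Gamma> H)
  then show ?thesis using assms(2) by (auto intro: entails_mono)
next
  case (cut \<Gamma> A \<Lambda> H)
  then show ?thesis using assms(2) by (auto intro: entails_cut)
\<comment> \<open>Exchange and contraction leave the set of the antecedent unchanged;
  \<open>insert_commute\<close> settles exchange.\<close>
qed (auto intro: entails.intros simp: insert_commute)

lemma is_derivation_sound:
  "is_derivation L d \<Longrightarrow>
   list_all (form_of L) (antecedent (conclusion d)) \<and>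
   entails L (set (antecedent (conclusion d))) (succedent (conclusion d))"
proof (induction d)
  case (Infer \<rho> S ds)
  then have "EQ' L \<rho> (map conclusion ds) S"
    by simp
  then show ?case
    unfolding tree.sel by (rule EQ'_sound) (use Infer in \<open>auto simp: list_all_iff\<close>)
qed

definition cut_contraction_free :: "('f, 'p) lang \<Rightarrow> ('f, 'p) sequent \<Rightarrow> bool" where
  "cut_contraction_free L S \<longleftrightarrow>
     (\<exists>d. derivation_of L d S \<and> Cut \<notin> rules_used d \<and> Contraction \<notin> rules_used d)"

lemma cut_contraction_free_rule:
  assumes "EQ' L \<rho> Ss S" and "\<rho> \<noteq> Cut" and "\<rho> \<noteq> Contraction"
    and "\<forall>S' \<in> set Ss. cut_contraction_free L S'"
  shows "cut_contraction_free L S"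
proof -
  \<comment> \<open>One derivation is chosen for each sequent, so mapping \<open>d\<close> over
    \<open>Ss\<close> yields the subtrees in the right order.\<close>
  obtain d where d: "\<And>S'. S' \<in> set Ss \<Longrightarrow>
      is_derivation L (d S') \<and> conclusion (d S') = S' \<and>
      Cut \<notin> rules_used (d S') \<and> Contraction \<notin> rules_used (d S')"
    using assms(4) unfolding cut_contraction_free_def derivation_of_def by metis
  have "map conclusion (map d Ss) = Ss"
    using d by (simp add: map_idI)
  then have "derivation_of L (Infer \<rho> S (map d Ss)) S"
    using assms(1) d by (auto simp: derivation_of_def list_all_iff)
  then show ?thesis
    unfolding cut_contraction_free_def using assms(2,3) d
    by (intro exI[of _ "Infer \<rho> S (map d Ss)"]) auto
qed

lemma cut_contraction_free_weaken:
  assumes "cut_contraction_free L (\<Gamma> \<turnstile> H)" and "list_all (form_of L) \<Delta>"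
  shows "cut_contraction_free L (\<Gamma> @ \<Delta> \<turnstile> H)"
  using assms(2)
proof (induction \<Delta> rule: rev_induct)
  case Nil
  then show ?case using assms(1) by simp
next
  case (snoc F \<Delta>)
  then show ?case
    using cut_contraction_free_rule[OF EQ'.weakening[of L F "\<Gamma> @ \<Delta>" H]] by simp
qed

text \<open>\<open>F\<close> passes one neighbour at a time; each formula passed joins the prefix,
  so the induction generalises over \<open>\<Theta>\<close>.\<close>

lemma cut_contraction_free_move:
  "cut_contraction_free L (\<Theta> @ F # \<Gamma> @ \<Delta> \<turnstile> H) \<Longrightarrow>
   cut_contraction_free L (\<Theta> @ \<Gamma> @ F # \<Delta> \<turnstile> H)"
proof (induction \<Gamma> arbitrary: \<Theta>)
  case Nil
  then show ?case by simp
next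
  case (Cons G \<Gamma>)
  then have "cut_contraction_free L ((\<Theta> @ [G]) @ F # \<Gamma> @ \<Delta> \<turnstile> H)"
    using cut_contraction_free_rule[OF EQ'.exchange[of L \<Theta> F G "\<Gamma> @ \<Delta>" H]] by simp
  from Cons.IH[OF this] show ?case by simp
qed

text \<open>The list \<open>\<Gamma>\<close> stays fixed throughout the induction, so
  \<open>congruence\<close> becomes an instance of the rule itself and nothing has to be
  contracted.\<close>

lemma entails_imp_cut_contraction_free:
  assumes "entails L (set \<Gamma>) H" and "list_all (form_of L) \<Gamma>"
  shows "cut_contraction_free L (\<Gamma> \<turnstile> H)"
  using assms(1)
proof (induction rule: entails.induct)
  case (hypothesis A)
  then obtain \<Gamma>1 \<Gamma>2 where \<Gamma>: "\<Gamma> = \<Gamma>1 @ Atom A # \<Gamma>2"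
    by (meson split_list)
  then have "cut_contraction_free L ([Atom A] \<turnstile> Atom A)"
    using assms(2) by (intro cut_contraction_free_rule[OF EQ'.logical_axiom]) auto
  \<comment> \<open>Weakening only appends on the right, so \<open>Atom A\<close> starts at the head
    and is then moved to its place.\<close>
  then have "cut_contraction_free L ([Atom A] @ \<Gamma>1 @ \<Gamma>2 \<turnstile> Atom A)"
    using assms(2) \<Gamma> by (intro cut_contraction_free_weaken) auto
  then show ?case
    using cut_contraction_free_move[of L "[]"] \<Gamma> by simp
next
  case (reflexivity t)
  then have "cut_contraction_free L ([] \<turnstile> Atom (Eq t t))"
    by (intro cut_contraction_free_rule[OF EQ'.reflexivity]) auto
  from cut_contraction_free_weaken[OF this assms(2)] show ?case by simp
next
  case (congruence D v r s)
  then show ?case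
    by (intro cut_contraction_free_rule[OF EQ'.congruence]) auto
qed

theorem corollary0p1:
  fixes L :: "('f, 'p) lang" and S :: "('f, 'p) sequent"
  assumes "derivable L S"
  shows "\<exists>d. derivation_of L d S \<and> Cut \<notin> rules_used d \<and> Contraction \<notin> rules_used d"
proof -
  have "list_all (form_of L) (antecedent S) \<and> entails L (set (antecedent S)) (succedent S)"
    using assms is_derivation_sound by (auto simp: derivable_def derivation_of_def)
  then have "cut_contraction_free L S"
    using entails_imp_cut_contraction_free by (cases S) auto
  then show ?thesis
    by (simp add: cut_contraction_free_def)
qed

end
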